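(* The variety $\mathsf{SNA}$ of subresiduated Nelson algebras has equationally definable principal congruences (EDPC).
   Context: A Kleene algebra is a bounded distributive lattice $\langle T,\wedge,\vee,0,1\rangle$ with a unary operation $\sim$ satisfying $\sim\sim x=x$, $\sim(x\wedge y)=\sim x\vee\sim y$, $(x\wedge\sim x)\wedge(y\vee\sim y)=x\wedge\sim x$. A subresiduated Nelson algebra is an algebra $\langle T,\wedge,\vee,\to,\sim,0,1\rangle$ of type $(2,2,2,1,0,0)$ such that $\langle T,\wedge,\vee,\sim,0,1\rangle$ is a Kleene algebra and for all $x,y,z\in T$: (1) $(x\vee y)\to z=(x\to z)\wedge(y\to z)$; (2) $z\to(x\wedge y)=(z\to x)\wedge(z\to y)$; (3) $((x\to y)\wedge(y\to z))\to(x\to z)=1$; (4) $x\to x=1$; (5) $x\wedge(x\to y)\le x\wedge(\sim x\vee y)$; (6) $x\to y\le z\to(x\to y)$; (7) $\sim(x\to y)\to(x\wedge\sim y)=1$; (8) $(x\wedge\sim y)\to\sim(x\to y)=1$. A variety $\mathcal V$ has EDPC if there are finitely many pairs of 4-ary terms $(p_i,q_i)$, $i=1,\dots,n$, in the language of $\mathcal V$ such that for every $T\in\mathcal V$ and all $x,y,z,w\in T$, the pair $(z,w)$ belongs to the least congruence of $T$ containing $(x,y)$ if and only if $p_i(x,y,z,w)=q_i(x,y,z,w)$ for all $i=1,\dots,n$. *)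

theory Defs
  imports Main
begin

record 'a nelson_struct =
  carrier :: "'a set"
  meet :: "'a \<Rightarrow> 'a \<Rightarrow> 'a"  (infixl \<open>\<sqinter>\<index>\<close> 70)
  join :: "'a \<Rightarrow> 'a \<Rightarrow> 'a"  (infixl \<open>\<squnion>\<index>\<close> 65)
  imp :: "'a \<Rightarrow> 'a \<Rightarrow> 'a"  (infixr \<open>\<rightarrow>\<index>\<close> 60)
  neg :: "'a \<Rightarrow> 'a"  (\<open>\<sim>\<index> _\<close> [81] 80)
  zero :: 'a  (\<open>\<zero>\<index>\<close>)
  one :: 'a  (\<open>\<one>\<index>\<close>)

definition leq :: "'a nelson_struct \<Rightarrow> 'a \<Rightarrow> 'a \<Rightarrow> bool"  (infix \<open>\<sqsubseteq>\<index>\<close> 50)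
  where "x \<sqsubseteq>\<^bsub>T\<^esub> y \<longleftrightarrow> x \<sqinter>\<^bsub>T\<^esub> y = x"

text \<open>The one-element algebra is admitted (\<open>\<zero> = \<one>\<close> is allowed).  The closure of the carrier
  under implication is listed in \<open>subresiduated_nelson_algebra\<close>.\<close>

locale kleene_algebra =
  fixes T :: "'a nelson_struct" (structure)
  assumes meet_closed: "\<lbrakk>x \<in> carrier T; y \<in> carrier T\<rbrakk> \<Longrightarrow> x \<sqinter> y \<in> carrier T"
    and join_closed: "\<lbrakk>x \<in> carrier T; y \<in> carrier T\<rbrakk> \<Longrightarrow> x \<squnion> y \<in> carrier T"
    and neg_closed: "x \<in> carrier T \<Longrightarrow> \<sim> x \<in> carrier T"
    and zero_closed: "\<zero> \<in> carrier T"
    and one_closed: "\<one> \<in> carrier T"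
    and meet_assoc: "\<lbrakk>x \<in> carrier T; y \<in> carrier T; z \<in> carrier T\<rbrakk>
      \<Longrightarrow> (x \<sqinter> y) \<sqinter> z = x \<sqinter> (y \<sqinter> z)"
    and join_assoc: "\<lbrakk>x \<in> carrier T; y \<in> carrier T; z \<in> carrier T\<rbrakk>
      \<Longrightarrow> (x \<squnion> y) \<squnion> z = x \<squnion> (y \<squnion> z)"
    and meet_commute: "\<lbrakk>x \<in> carrier T; y \<in> carrier T\<rbrakk> \<Longrightarrow> x \<sqinter> y = y \<sqinter> x"
    and join_commute: "\<lbrakk>x \<in> carrier T; y \<in> carrier T\<rbrakk> \<Longrightarrow> x \<squnion> y = y \<squnion> x"
    and meet_join_absorb: "\<lbrakk>x \<in> carrier T; y \<in> carrier T\<rbrakk> \<Longrightarrow> x \<sqinter> (x \<squnion> y) = x"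
    and join_meet_absorb: "\<lbrakk>x \<in> carrier T; y \<in> carrier T\<rbrakk> \<Longrightarrow> x \<squnion> (x \<sqinter> y) = x"
    and meet_join_distrib: "\<lbrakk>x \<in> carrier T; y \<in> carrier T; z \<in> carrier T\<rbrakk>
      \<Longrightarrow> x \<sqinter> (y \<squnion> z) = (x \<sqinter> y) \<squnion> (x \<sqinter> z)"
    and zero_least: "x \<in> carrier T \<Longrightarrow> \<zero> \<sqsubseteq> x"
    and one_greatest: "x \<in> carrier T \<Longrightarrow> x \<sqsubseteq> \<one>"
    and neg_neg: "x \<in> carrier T \<Longrightarrow> \<sim> (\<sim> x) = x"
    and neg_meet: "\<lbrakk>x \<in> carrier T; y \<in> carrier T\<rbrakk> \<Longrightarrow> \<sim> (x \<sqinter> y) = \<sim> x \<squnion> \<sim> y"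
    and kleene: "\<lbrakk>x \<in> carrier T; y \<in> carrier T\<rbrakk>
      \<Longrightarrow> (x \<sqinter> \<sim> x) \<sqinter> (y \<squnion> \<sim> y) = x \<sqinter> \<sim> x"

locale subresiduated_nelson_algebra = kleene_algebra +
  assumes imp_closed: "\<lbrakk>x \<in> carrier T; y \<in> carrier T\<rbrakk> \<Longrightarrow> x \<rightarrow> y \<in> carrier T"
    and join_imp: "\<lbrakk>x \<in> carrier T; y \<in> carrier T; z \<in> carrier T\<rbrakk>
      \<Longrightarrow> (x \<squnion> y) \<rightarrow> z = (x \<rightarrow> z) \<sqinter> (y \<rightarrow> z)"
    and imp_meet: "\<lbrakk>x \<in> carrier T; y \<in> carrier T; z \<in> carrier T\<rbrakk>
      \<Longrightarrow> z \<rightarrow> (x \<sqinter> y) = (z \<rightarrow> x) \<sqinter> (z \<rightarrow> y)"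
    and imp_trans: "\<lbrakk>x \<in> carrier T; y \<in> carrier T; z \<in> carrier T\<rbrakk>
      \<Longrightarrow> ((x \<rightarrow> y) \<sqinter> (y \<rightarrow> z)) \<rightarrow> (x \<rightarrow> z) = \<one>"
    and imp_refl: "x \<in> carrier T \<Longrightarrow> x \<rightarrow> x = \<one>"
    and meet_imp_le: "\<lbrakk>x \<in> carrier T; y \<in> carrier T\<rbrakk>
      \<Longrightarrow> x \<sqinter> (x \<rightarrow> y) \<sqsubseteq> x \<sqinter> (\<sim> x \<squnion> y)"
    and imp_le_imp: "\<lbrakk>x \<in> carrier T; y \<in> carrier T; z \<in> carrier T\<rbrakk>
      \<Longrightarrow> x \<rightarrow> y \<sqsubseteq> z \<rightarrow> (x \<rightarrow> y)"
    and neg_imp_imp: "\<lbrakk>x \<in> carrier T; y \<in> carrier T\<rbrakk>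
      \<Longrightarrow> \<sim> (x \<rightarrow> y) \<rightarrow> (x \<sqinter> \<sim> y) = \<one>"
    and imp_neg_imp: "\<lbrakk>x \<in> carrier T; y \<in> carrier T\<rbrakk>
      \<Longrightarrow> (x \<sqinter> \<sim> y) \<rightarrow> \<sim> (x \<rightarrow> y) = \<one>"

definition SNA :: "'a itself \<Rightarrow> 'a nelson_struct set"
  where "SNA _ = {T. subresiduated_nelson_algebra T}"

definition is_congruence :: "'a nelson_struct \<Rightarrow> 'a rel \<Rightarrow> bool"
  where "is_congruence T \<theta> \<longleftrightarrow>
    equiv (carrier T) \<theta> \<and>
    (\<forall>a b c d. (a, b) \<in> \<theta> \<longrightarrow> (c, d) \<in> \<theta> \<longrightarrow>
      (a \<sqinter>\<^bsub>T\<^esub> c, b \<sqinter>\<^bsub>T\<^esub> d) \<in> \<theta> \<and>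
      (a \<squnion>\<^bsub>T\<^esub> c, b \<squnion>\<^bsub>T\<^esub> d) \<in> \<theta> \<and>
      (a \<rightarrow>\<^bsub>T\<^esub> c, b \<rightarrow>\<^bsub>T\<^esub> d) \<in> \<theta>) \<and>
    (\<forall>a b. (a, b) \<in> \<theta> \<longrightarrow> (\<sim>\<^bsub>T\<^esub> a, \<sim>\<^bsub>T\<^esub> b) \<in> \<theta>)"

definition principal_congruence :: "'a nelson_struct \<Rightarrow> 'a \<Rightarrow> 'a \<Rightarrow> 'a rel"
  where "principal_congruence T x y = \<Inter>{\<theta>. is_congruence T \<theta> \<and> (x, y) \<in> \<theta>}"

datatype 'v nelson_term =
    Var 'v
  | Zero
  | One
  | Neg "'v nelson_term"
  | Meet "'v nelson_term" "'v nelson_term"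
  | Join "'v nelson_term" "'v nelson_term"
  | Imp "'v nelson_term" "'v nelson_term"

primrec eval :: "'a nelson_struct \<Rightarrow> ('v \<Rightarrow> 'a) \<Rightarrow> 'v nelson_term \<Rightarrow> 'a"
  where
    "eval T \<rho> (Var v) = \<rho> v"
  | "eval T \<rho> Zero = \<zero>\<^bsub>T\<^esub>"
  | "eval T \<rho> One = \<one>\<^bsub>T\<^esub>"
  | "eval T \<rho> (Neg s) = \<sim>\<^bsub>T\<^esub> (eval T \<rho> s)"
  | "eval T \<rho> (Meet s t) = eval T \<rho> s \<sqinter>\<^bsub>T\<^esub> eval T \<rho> t"
  | "eval T \<rho> (Join s t) = eval T \<rho> s \<squnion>\<^bsub>T\<^esub> eval T \<rho> t"
  | "eval T \<rho> (Imp s t) = eval T \<rho> s \<rightarrow>\<^bsub>T\<^esub> eval T \<rho> t"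

datatype var4 = V1 | V2 | V3 | V4

definition eval4 :: "'a nelson_struct \<Rightarrow> var4 nelson_term \<Rightarrow> 'a \<Rightarrow> 'a \<Rightarrow> 'a \<Rightarrow> 'a \<Rightarrow> 'a"
  where "eval4 T p x y z w = eval T (case_var4 x y z w) p"

text \<open>\<open>defines_principal_congruences K ps\<close>: the finitely many pairs of 4-ary terms in the list
  \<open>ps\<close> witness EDPC for the algebras in \<open>K\<close>.  EDPC asks for one \<open>ps\<close> serving all algebras of the
  variety.  A single \<open>K\<close> contains only the algebras whose carrier lies in one fixed type, and
  types cannot be quantified inside a formula; in a statement of the form
  \<open>\<exists>ps. defines_principal_congruences (SNA TYPE('a)) ps\<close> the choice of \<open>ps\<close> could
  therefore vary with \<open>'a\<close>.  To keep \<open>ps\<close> independent of the type, take it from the algebras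
  whose carrier is a set of naturals and require, for every type \<open>'a\<close>, that it also serves
  the algebras with carrier in \<open>'a\<close>.\<close>

definition defines_principal_congruences ::
    "'a nelson_struct set \<Rightarrow> (var4 nelson_term \<times> var4 nelson_term) list \<Rightarrow> bool"
  where "defines_principal_congruences K ps \<longleftrightarrow>
    (\<forall>T\<in>K. \<forall>x\<in>carrier T. \<forall>y\<in>carrier T. \<forall>z\<in>carrier T. \<forall>w\<in>carrier T.
      (z, w) \<in> principal_congruence T x y \<longleftrightarrow>
      (\<forall>(p, q)\<in>set ps. eval4 T p x y z w = eval4 T q x y z w))"

end

theory Submission
  imports Defs "HOL-Library.Countable"
begin

text \<open>
  Write \<open>a \<lesssim> b\<close> for \<open>a \<rightarrow> b = \<one>\<close>.  In a subresiduated Nelson algebra this is a preorder, coarser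
  than the lattice order, for which \<open>\<sqinter>\<close> and \<open>\<squnion>\<close> are still meets and joins.  Moreover, if \<open>c\<close> is
  open, meaning \<open>c \<sqsubseteq> q \<rightarrow> c\<close> for all \<open>q\<close>, then \<open>c \<lesssim> a \<rightarrow> b\<close> is equivalent to \<open>c \<sqinter> a \<lesssim> b\<close>.
  The element
  \<open>c(x,y) = (x \<rightarrow> y) \<sqinter> (y \<rightarrow> x) \<sqinter> (\<sim> x \<rightarrow> \<sim> y) \<sqinter> (\<sim> y \<rightarrow> \<sim> x)\<close>
  is open, being a meet of implications, and it measures how close \<open>x\<close> and \<open>y\<close> are to being equal:
  a congruence identifies \<open>x\<close> with \<open>y\<close> exactly if it identifies \<open>c(x,y)\<close> with \<open>\<one>\<close>
  (\<open>congruence_iff_equivalence_one\<close>; this is where the Kleene law enters).  Thus a congruence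
  containing \<open>(x,y)\<close> also contains \<open>(z,w)\<close> as soon as \<open>c(x,y) \<lesssim> c(z,w)\<close>, because
  \<open>\<one> \<rightarrow> a \<sqsubseteq> a\<close>.  Conversely, the pairs \<open>(z,w)\<close> with \<open>c(x,y) \<lesssim> c(z,w)\<close> form a congruence: the
  condition says that \<open>z\<close> and \<open>w\<close>, and also \<open>\<sim> z\<close> and
  \<open>\<sim> w\<close>, are equivalent for the preorder \<open>\<lesssim>\<close> relativised to \<open>c(x,y)\<close>, and this is compatible with
  the operations (\<open>is_congruence_relative_congruence\<close>).  Hence the single equation
  \<open>c(x,y) \<rightarrow> c(z,w) = \<one>\<close> defines principal congruences in every subresiduated Nelson algebra.

  The second half of the theorem says that the algebras with countable carrier suffice to test
  whether given equations define principal congruences.  Both the given equations and the equation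
  above only depend on the subalgebra generated by \<open>x, y, z, w\<close>, which is countable and thus
  isomorphic to an algebra on a set of naturals.  There the two conditions agree, since both define
  the same principal congruence; so they agree in the original algebra.
\<close>

section \<open>The Kleene lattice order\<close>

context kleene_algebra
begin

lemmas closed [simp] = meet_closed join_closed neg_closed zero_closed one_closed

lemma meet_idem:
  assumes "x \<in> carrier T"
  shows "x \<sqinter> x = x"
proof -
  have "x \<sqinter> (x \<squnion> (x \<sqinter> x)) = x" using assms by (intro meet_join_absorb) auto
  then show ?thesis using assms by (simp add: join_meet_absorb)
qed

lemma leq_antisym:
  assumes "x \<sqsubseteq> y" "y \<sqsubseteq> x" "x \<in> carrier T" "y \<in> carrier T"
  shows "x = y"
  using assms meet_commute unfolding leq_def by metis

lemma leq_trans: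
  assumes "x \<sqsubseteq> y" "y \<sqsubseteq> z" "x \<in> carrier T" "y \<in> carrier T" "z \<in> carrier T"
  shows "x \<sqsubseteq> z"
  using assms meet_assoc unfolding leq_def by metis

lemma meet_lower1:
  assumes "x \<in> carrier T" "y \<in> carrier T"
  shows "x \<sqinter> y \<sqsubseteq> x"
proof -
  have "(x \<sqinter> y) \<sqinter> x = x \<sqinter> (x \<sqinter> y)" using assms by (intro meet_commute) auto
  also have "\<dots> = (x \<sqinter> x) \<sqinter> y" using assms by (simp add: meet_assoc)
  finally show ?thesis using assms by (simp add: leq_def meet_idem)
qed

lemma meet_lower2:
  assumes "x \<in> carrier T" "y \<in> carrier T"
  shows "x \<sqinter> y \<sqsubseteq> y"
  using assms by (simp add: leq_def meet_assoc meet_idem)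

lemma meet_greatest:
  assumes "z \<sqsubseteq> x" "z \<sqsubseteq> y" "x \<in> carrier T" "y \<in> carrier T" "z \<in> carrier T"
  shows "z \<sqsubseteq> x \<sqinter> y"
proof -
  have "z \<sqinter> (x \<sqinter> y) = (z \<sqinter> x) \<sqinter> y" using assms by (simp add: meet_assoc)
  then show ?thesis using assms by (simp add: leq_def)
qed

lemma leq_iff_join:
  assumes "x \<in> carrier T" "y \<in> carrier T"
  shows "x \<sqsubseteq> y \<longleftrightarrow> x \<squnion> y = y"
proof
  assume "x \<sqsubseteq> y"
  then have "x = y \<sqinter> x" using assms by (simp add: leq_def meet_commute)
  then show "x \<squnion> y = y" using assms by (metis join_commute join_meet_absorb)
next
  assume "x \<squnion> y = y"
  then show "x \<sqsubseteq> y" using assms by (metis leq_def meet_join_absorb)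
qed

lemma join_upper1: "\<lbrakk>x \<in> carrier T; y \<in> carrier T\<rbrakk> \<Longrightarrow> x \<sqsubseteq> x \<squnion> y"
  by (simp add: leq_def meet_join_absorb)

lemma join_upper2: "\<lbrakk>x \<in> carrier T; y \<in> carrier T\<rbrakk> \<Longrightarrow> y \<sqsubseteq> x \<squnion> y"
  using join_upper1[of y x] by (simp add: join_commute)

lemma join_least:
  assumes "x \<sqsubseteq> z" "y \<sqsubseteq> z" "x \<in> carrier T" "y \<in> carrier T" "z \<in> carrier T"
  shows "x \<squnion> y \<sqsubseteq> z"
  using assms by (simp add: leq_iff_join join_assoc)

lemma meet_one: "x \<in> carrier T \<Longrightarrow> x \<sqinter> \<one> = x"
  using one_greatest by (simp add: leq_def)

lemma one_meet: "x \<in> carrier T \<Longrightarrow> \<one> \<sqinter> x = x"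
  using meet_one[of x] meet_commute[of \<one> x] by simp

lemma join_zero: "x \<in> carrier T \<Longrightarrow> x \<squnion> \<zero> = x"
  using leq_iff_join[of \<zero> x] zero_least[of x] join_commute[of x \<zero>] by simp

lemma meet_eq_one_iff:
  assumes "x \<in> carrier T" "y \<in> carrier T"
  shows "x \<sqinter> y = \<one> \<longleftrightarrow> x = \<one> \<and> y = \<one>"
proof
  assume eq: "x \<sqinter> y = \<one>"
  have "\<one> \<sqsubseteq> x" "\<one> \<sqsubseteq> y"
    using meet_lower1[of x y] meet_lower2[of x y] eq assms by simp_all
  then show "x = \<one> \<and> y = \<one>"
    using assms by (auto intro!: leq_antisym one_greatest)
qed (simp add: meet_one)

lemma leq_by_cases:
  assumes "a \<sqsubseteq> b \<squnion> d" "a \<sqinter> b \<sqsubseteq> r" "a \<sqinter> d \<sqsubseteq> r"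
    and "a \<in> carrier T" "b \<in> carrier T" "d \<in> carrier T" "r \<in> carrier T"
  shows "a \<sqsubseteq> r"
proof -
  have "a = (a \<sqinter> b) \<squnion> (a \<sqinter> d)"
    using assms by (simp add: leq_def meet_join_distrib)
  then show ?thesis using assms join_least[of "a \<sqinter> b" r "a \<sqinter> d"] by simp
qed

lemma neg_join:
  assumes "x \<in> carrier T" "y \<in> carrier T"
  shows "\<sim> (x \<squnion> y) = \<sim> x \<sqinter> \<sim> y"
  using assms neg_meet[of "\<sim> x" "\<sim> y"] by (metis meet_closed neg_closed neg_neg)

lemma neg_antimono:
  assumes "x \<sqsubseteq> y" "x \<in> carrier T" "y \<in> carrier T"
  shows "\<sim> y \<sqsubseteq> \<sim> x"
proof -
  have "\<sim> x = \<sim> x \<squnion> \<sim> y" using assms neg_meet[of x y] by (simp add: leq_def)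
  then show ?thesis using assms join_upper2[of "\<sim> x" "\<sim> y"] by simp
qed

lemma neg_one: "\<sim> \<one> = \<zero>"
proof -
  have "\<sim> \<one> \<sqsubseteq> \<sim> (\<sim> \<zero>)" by (intro neg_antimono one_greatest) auto
  then show ?thesis by (auto intro!: leq_antisym zero_least simp: neg_neg)
qed

end

section \<open>The preorder defined by implication\<close>

context subresiduated_nelson_algebra
begin

declare imp_closed [simp]

abbreviation below :: "'a \<Rightarrow> 'a \<Rightarrow> bool" (infix \<open>\<lesssim>\<close> 50)
  where "a \<lesssim> b \<equiv> a \<rightarrow> b = \<one>"

lemma one_imp_leq:
  assumes "a \<in> carrier T"
  shows "\<one> \<rightarrow> a \<sqsubseteq> a"
proof -
  have "\<one> \<sqinter> (\<one> \<rightarrow> a) \<sqsubseteq> \<one> \<sqinter> (\<sim> \<one> \<squnion> a)" using assms by (intro meet_imp_le) auto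
  then show ?thesis
    using assms by (simp add: neg_one one_meet join_commute[of \<zero>] join_zero)
qed

lemma one_below_iff:
  assumes "a \<in> carrier T"
  shows "\<one> \<lesssim> a \<longleftrightarrow> a = \<one>"
  using assms one_imp_leq[of a] imp_refl[of \<one>] by (auto intro!: leq_antisym one_greatest)

lemma leq_imp_below:
  assumes "a \<sqsubseteq> b" "a \<in> carrier T" "b \<in> carrier T"
  shows "a \<lesssim> b"
proof -
  have "a \<rightarrow> (a \<sqinter> b) = (a \<rightarrow> a) \<sqinter> (a \<rightarrow> b)" using assms by (intro imp_meet) auto
  then show ?thesis using assms by (simp add: leq_def imp_refl one_meet)
qed

lemma below_trans:
  assumes "a \<lesssim> b" "b \<lesssim> d" "a \<in> carrier T" "b \<in> carrier T" "d \<in> carrier T"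
  shows "a \<lesssim> d"
  using imp_trans[of a b d] assms by (simp add: meet_one one_below_iff)

lemma below_meet_iff:
  assumes "a \<in> carrier T" "b \<in> carrier T" "d \<in> carrier T"
  shows "a \<lesssim> b \<sqinter> d \<longleftrightarrow> a \<lesssim> b \<and> a \<lesssim> d"
  using assms by (simp add: imp_meet meet_eq_one_iff)

lemma join_below_iff:
  assumes "a \<in> carrier T" "b \<in> carrier T" "d \<in> carrier T"
  shows "a \<squnion> b \<lesssim> d \<longleftrightarrow> a \<lesssim> d \<and> b \<lesssim> d"
  using assms by (simp add: join_imp meet_eq_one_iff)

lemma imp_below_mono:
  assumes "a \<lesssim> b" "a \<in> carrier T" "b \<in> carrier T" "q \<in> carrier T"
  shows "q \<rightarrow> a \<lesssim> q \<rightarrow> b"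
  using imp_trans[of q a b] assms by (simp add: meet_one)

text \<open>Axiom (8) with equal arguments makes contradictions least for the preorder, although they
  need not be \<open>\<zero>\<close>.\<close>

lemma contradiction_below:
  assumes "q \<in> carrier T" "r \<in> carrier T"
  shows "q \<sqinter> \<sim> q \<lesssim> r"
proof -
  have "q \<sqinter> \<sim> q \<lesssim> \<zero>"
    using imp_neg_imp[of q q] assms by (simp add: imp_refl neg_one)
  moreover have "\<zero> \<lesssim> r" using assms by (intro leq_imp_below zero_least) auto
  ultimately show ?thesis using assms below_trans[of "q \<sqinter> \<sim> q" \<zero> r] by simp
qed

text \<open>Axiom (5) gives modus ponens only up to a contradiction, which the preorder discards.\<close>

lemma modus_ponens:
  assumes "q \<in> carrier T" "r \<in> carrier T"
  shows "q \<sqinter> (q \<rightarrow> r) \<lesssim> r"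
proof -
  have "q \<sqinter> (\<sim> q \<squnion> r) = (q \<sqinter> \<sim> q) \<squnion> (q \<sqinter> r)"
    using assms by (simp add: meet_join_distrib)
  moreover have "(q \<sqinter> \<sim> q) \<squnion> (q \<sqinter> r) \<lesssim> r"
    using assms by (simp add: join_below_iff contradiction_below leq_imp_below meet_lower2)
  moreover have "q \<sqinter> (q \<rightarrow> r) \<lesssim> q \<sqinter> (\<sim> q \<squnion> r)"
    using assms by (intro leq_imp_below meet_imp_le) auto
  ultimately show ?thesis
    using assms below_trans[of "q \<sqinter> (q \<rightarrow> r)" "q \<sqinter> (\<sim> q \<squnion> r)" r] by simp
qed

text \<open>In the preorder quotient, which is a subresiduated lattice, the open elements are those of
  the distinguished sublattice: only these are residuated by the implication.\<close>

definition is_open :: "'a \<Rightarrow> bool"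
  where "is_open c \<longleftrightarrow> c \<in> carrier T \<and> (\<forall>q\<in>carrier T. c \<sqsubseteq> q \<rightarrow> c)"

lemma is_open_closed: "is_open c \<Longrightarrow> c \<in> carrier T"
  by (simp add: is_open_def)

lemma is_open_imp [simp]: "\<lbrakk>a \<in> carrier T; b \<in> carrier T\<rbrakk> \<Longrightarrow> is_open (a \<rightarrow> b)"
  by (simp add: is_open_def imp_le_imp)

lemma is_open_meet [simp]:
  assumes "is_open c" "is_open d"
  shows "is_open (c \<sqinter> d)"
proof -
  have "c \<sqinter> d \<sqsubseteq> q \<rightarrow> (c \<sqinter> d)" if q: "q \<in> carrier T" for q
  proof -
    have C: "c \<in> carrier T" "d \<in> carrier T" using assms by (auto dest: is_open_closed)
    have "c \<sqsubseteq> q \<rightarrow> c" "d \<sqsubseteq> q \<rightarrow> d" using assms q by (auto simp: is_open_def)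
    then have "c \<sqinter> d \<sqsubseteq> q \<rightarrow> c" "c \<sqinter> d \<sqsubseteq> q \<rightarrow> d"
      using leq_trans[OF meet_lower1[of c d]] leq_trans[OF meet_lower2[of c d]] C q by auto
    then show ?thesis using C q by (simp add: imp_meet meet_greatest)
  qed
  then show ?thesis using assms by (simp add: is_open_def)
qed

text \<open>From left to right this is modus ponens.  Openness of \<open>c\<close> is what the converse rests on:
  \<open>c \<sqsubseteq> a \<rightarrow> c = a \<rightarrow> (c \<sqinter> a) \<lesssim> a \<rightarrow> b\<close>.\<close>

lemma open_residuation:
  assumes c: "is_open c" and ab: "a \<in> carrier T" "b \<in> carrier T"
  shows "c \<lesssim> a \<rightarrow> b \<longleftrightarrow> c \<sqinter> a \<lesssim> b"
proof
  have C [simp]: "c \<in> carrier T" using c by (rule is_open_closed)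
  note ab [simp]
  assume 1: "c \<lesssim> a \<rightarrow> b"
  have "c \<sqinter> a \<lesssim> a \<rightarrow> b"
    using below_trans[OF leq_imp_below[OF meet_lower1] 1] by simp
  moreover have "c \<sqinter> a \<lesssim> a" by (simp add: leq_imp_below meet_lower2)
  ultimately have "c \<sqinter> a \<lesssim> a \<sqinter> (a \<rightarrow> b)" by (simp add: below_meet_iff)
  from below_trans[OF this modus_ponens] show "c \<sqinter> a \<lesssim> b" by simp
next
  have C [simp]: "c \<in> carrier T" using c by (rule is_open_closed)
  note ab [simp]
  assume 1: "c \<sqinter> a \<lesssim> b"
  have "a \<rightarrow> (c \<sqinter> a) = a \<rightarrow> c" by (simp add: imp_meet imp_refl meet_one)
  moreover have "c \<sqsubseteq> a \<rightarrow> c" using c by (simp add: is_open_def)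
  ultimately have "c \<lesssim> a \<rightarrow> (c \<sqinter> a)" by (simp add: leq_imp_below)
  from below_trans[OF this imp_below_mono[OF 1]] show "c \<lesssim> a \<rightarrow> b" by simp
qed

section \<open>Congruences from open elements\<close>

definition equivalence :: "'a \<Rightarrow> 'a \<Rightarrow> 'a"
  where "equivalence x y = (x \<rightarrow> y) \<sqinter> (y \<rightarrow> x) \<sqinter> (\<sim> x \<rightarrow> \<sim> y) \<sqinter> (\<sim> y \<rightarrow> \<sim> x)"

lemma is_open_equivalence [simp]:
  "\<lbrakk>x \<in> carrier T; y \<in> carrier T\<rbrakk> \<Longrightarrow> is_open (equivalence x y)"
  by (simp add: equivalence_def)

lemma equivalence_closed [simp]:
  "\<lbrakk>x \<in> carrier T; y \<in> carrier T\<rbrakk> \<Longrightarrow> equivalence x y \<in> carrier T"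
  by (simp add: equivalence_def)

lemma equivalence_refl: "x \<in> carrier T \<Longrightarrow> equivalence x x = \<one>"
  by (simp add: equivalence_def imp_refl meet_one)

lemma equivalence_leq:
  assumes "x \<in> carrier T" "y \<in> carrier T"
  shows "equivalence x y \<sqsubseteq> x \<rightarrow> y" "equivalence x y \<sqsubseteq> y \<rightarrow> x"
    "equivalence x y \<sqsubseteq> \<sim> x \<rightarrow> \<sim> y" "equivalence x y \<sqsubseteq> \<sim> y \<rightarrow> \<sim> x"
proof -
  define p where "p = x \<rightarrow> y"
  define q where "q = y \<rightarrow> x"
  define r where "r = \<sim> x \<rightarrow> \<sim> y"
  define s where "s = \<sim> y \<rightarrow> \<sim> x"
  have C [simp]: "p \<in> carrier T" "q \<in> carrier T" "r \<in> carrier T" "s \<in> carrier T"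
    using assms by (auto simp: p_def q_def r_def s_def)
  have pqr: "p \<sqinter> q \<sqinter> r \<sqinter> s \<sqsubseteq> p \<sqinter> q \<sqinter> r" by (simp add: meet_lower1)
  have pq: "p \<sqinter> q \<sqinter> r \<sqinter> s \<sqsubseteq> p \<sqinter> q" using leq_trans[OF pqr meet_lower1] by simp
  have "p \<sqinter> q \<sqinter> r \<sqinter> s \<sqsubseteq> p" using leq_trans[OF pq meet_lower1] by simp
  moreover have "p \<sqinter> q \<sqinter> r \<sqinter> s \<sqsubseteq> q" using leq_trans[OF pq meet_lower2] by simp
  moreover have "p \<sqinter> q \<sqinter> r \<sqinter> s \<sqsubseteq> r"
    using leq_trans[OF pqr meet_lower2] by simp
  moreover have "p \<sqinter> q \<sqinter> r \<sqinter> s \<sqsubseteq> s" using meet_lower2[of "p \<sqinter> q \<sqinter> r" s] by simp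
  ultimately show "equivalence x y \<sqsubseteq> x \<rightarrow> y" "equivalence x y \<sqsubseteq> y \<rightarrow> x"
    "equivalence x y \<sqsubseteq> \<sim> x \<rightarrow> \<sim> y" "equivalence x y \<sqsubseteq> \<sim> y \<rightarrow> \<sim> x"
    by (simp_all add: equivalence_def p_def q_def r_def s_def)
qed

definition below_rel :: "'a \<Rightarrow> 'a \<Rightarrow> 'a \<Rightarrow> bool"
  where "below_rel c a b \<longleftrightarrow> c \<sqinter> a \<lesssim> b"

definition relative_congruence :: "'a \<Rightarrow> 'a rel"
  where "relative_congruence c = {(z, w). z \<in> carrier T \<and> w \<in> carrier T \<and>
    below_rel c z w \<and> below_rel c w z \<and> below_rel c (\<sim> z) (\<sim> w) \<and> below_rel c (\<sim> w) (\<sim> z)}"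

lemma relative_congruence_iff:
  assumes "is_open c" "z \<in> carrier T" "w \<in> carrier T"
  shows "(z, w) \<in> relative_congruence c \<longleftrightarrow> c \<lesssim> equivalence z w"
  using assms is_open_closed[OF assms(1)]
  by (auto simp: relative_congruence_def below_rel_def equivalence_def below_meet_iff
      open_residuation)

lemma below_imp_below_rel:
  assumes "a \<lesssim> b" "c \<in> carrier T" "a \<in> carrier T" "b \<in> carrier T"
  shows "below_rel c a b"
  unfolding below_rel_def
  using below_trans[OF leq_imp_below[OF meet_lower2] assms(1)] assms by simp

lemma below_rel_refl:
  assumes "c \<in> carrier T" "a \<in> carrier T"
  shows "below_rel c a a"
  using assms by (simp add: below_imp_below_rel imp_refl)

lemma below_rel_trans:
  assumes "below_rel c a b" "below_rel c b d"
    and C: "c \<in> carrier T" "a \<in> carrier T" "b \<in> carrier T" "d \<in> carrier T"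
  shows "below_rel c a d"
proof -
  have "c \<sqinter> a \<lesssim> c \<sqinter> b"
    using assms by (simp add: below_rel_def below_meet_iff leq_imp_below meet_lower1)
  then show ?thesis
    using assms below_trans[of "c \<sqinter> a" "c \<sqinter> b" d] by (simp add: below_rel_def)
qed

lemma below_rel_meet:
  assumes "below_rel c a a'" "below_rel c b b'"
    and C [simp]: "c \<in> carrier T" "a \<in> carrier T" "a' \<in> carrier T" "b \<in> carrier T" "b' \<in> carrier T"
  shows "below_rel c (a \<sqinter> b) (a' \<sqinter> b')"
proof -
  have "below_rel c (a \<sqinter> b) a" "below_rel c (a \<sqinter> b) b"
    by (simp_all add: below_imp_below_rel leq_imp_below meet_lower1 meet_lower2)
  then have "below_rel c (a \<sqinter> b) a'" "below_rel c (a \<sqinter> b) b'"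
    using assms(1,2) below_rel_trans[of c "a \<sqinter> b" a a'] below_rel_trans[of c "a \<sqinter> b" b b']
    by auto
  then show ?thesis by (simp add: below_rel_def below_meet_iff)
qed

lemma below_rel_join:
  assumes "below_rel c a a'" "below_rel c b b'"
    and C [simp]: "c \<in> carrier T" "a \<in> carrier T" "a' \<in> carrier T" "b \<in> carrier T" "b' \<in> carrier T"
  shows "below_rel c (a \<squnion> b) (a' \<squnion> b')"
proof -
  have "below_rel c a' (a' \<squnion> b')" "below_rel c b' (a' \<squnion> b')"
    by (simp_all add: below_imp_below_rel leq_imp_below join_upper1 join_upper2)
  then have "below_rel c a (a' \<squnion> b')" "below_rel c b (a' \<squnion> b')"
    using assms(1,2) below_rel_trans[of c a a' "a' \<squnion> b'"] below_rel_trans[of c b b' "a' \<squnion> b'"]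
    by auto
  then show ?thesis by (simp add: below_rel_def meet_join_distrib join_below_iff)
qed

lemma below_rel_imp:
  assumes c: "is_open c" and rel: "below_rel c a' a" "below_rel c b b'"
    and C [simp]: "a \<in> carrier T" "a' \<in> carrier T" "b \<in> carrier T" "b' \<in> carrier T"
  shows "below_rel c (a \<rightarrow> b) (a' \<rightarrow> b')"
proof -
  have [simp]: "c \<in> carrier T" using c by (rule is_open_closed)
  have "below_rel c (a' \<sqinter> (a \<rightarrow> b)) (a \<sqinter> (a \<rightarrow> b))"
    using rel by (simp add: below_rel_meet below_rel_refl)
  moreover have "below_rel c (a \<sqinter> (a \<rightarrow> b)) b"
    by (simp add: below_imp_below_rel modus_ponens)
  ultimately have "below_rel c (a' \<sqinter> (a \<rightarrow> b)) b'"
    using rel below_rel_trans[of c "a' \<sqinter> (a \<rightarrow> b)" "a \<sqinter> (a \<rightarrow> b)" b]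
      below_rel_trans[of c "a' \<sqinter> (a \<rightarrow> b)" b b'] by simp
  then have "(c \<sqinter> (a \<rightarrow> b)) \<sqinter> a' \<lesssim> b'"
    by (simp add: below_rel_def meet_assoc meet_commute[of a'])
  then show ?thesis
    using c by (simp add: below_rel_def open_residuation)
qed

text \<open>Axioms (7) and (8) make \<open>\<sim> (a \<rightarrow> b)\<close> equivalent to \<open>a \<sqinter> \<sim> b\<close>, so that a
  hypothesis on \<open>\<sim> b\<close> controls it; in general \<open>\<sim>\<close> does not reverse the preorder.\<close>

lemma below_rel_neg_imp:
  assumes rel: "below_rel c a a'" "below_rel c (\<sim> b) (\<sim> b')"
    and C [simp]: "c \<in> carrier T" "a \<in> carrier T" "a' \<in> carrier T" "b \<in> carrier T" "b' \<in> carrier T"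
  shows "below_rel c (\<sim> (a \<rightarrow> b)) (\<sim> (a' \<rightarrow> b'))"
proof -
  have "below_rel c (\<sim> (a \<rightarrow> b)) (a \<sqinter> \<sim> b)"
    by (simp add: below_imp_below_rel neg_imp_imp)
  moreover have "below_rel c (a \<sqinter> \<sim> b) (a' \<sqinter> \<sim> b')"
    using rel by (simp add: below_rel_meet)
  moreover have "below_rel c (a' \<sqinter> \<sim> b') (\<sim> (a' \<rightarrow> b'))"
    by (simp add: below_imp_below_rel imp_neg_imp)
  ultimately show ?thesis
    using below_rel_trans[of c "\<sim> (a \<rightarrow> b)" "a \<sqinter> \<sim> b" "a' \<sqinter> \<sim> b'"]
      below_rel_trans[of c "\<sim> (a \<rightarrow> b)" "a' \<sqinter> \<sim> b'" "\<sim> (a' \<rightarrow> b')"] by simp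
qed

lemma is_congruence_relative_congruence:
  assumes c: "is_open c"
  shows "is_congruence T (relative_congruence c)"
proof -
  have [simp]: "c \<in> carrier T" using c by (rule is_open_closed)
  have "refl_on (carrier T) (relative_congruence c)"
    by (auto simp: refl_on_def relative_congruence_def below_rel_refl)
  moreover have "relative_congruence c \<subseteq> carrier T \<times> carrier T"
    by (auto simp: relative_congruence_def)
  moreover have "sym (relative_congruence c)"
    by (auto simp: sym_def relative_congruence_def)
  moreover have "trans (relative_congruence c)"
    unfolding trans_def relative_congruence_def
    by (auto intro: below_rel_trans[OF _ _ \<open>c \<in> carrier T\<close>])
  ultimately have "equiv (carrier T) (relative_congruence c)"
    by (simp add: equiv_def)
  moreover have "(a \<sqinter> a', b \<sqinter> b') \<in> relative_congruence c"
    "(a \<squnion> a', b \<squnion> b') \<in> relative_congruence c"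
    "(a \<rightarrow> a', b \<rightarrow> b') \<in> relative_congruence c"
    if "(a, b) \<in> relative_congruence c" "(a', b') \<in> relative_congruence c" for a b a' b'
    using that c unfolding relative_congruence_def
    by (auto simp: neg_meet neg_join below_rel_meet below_rel_join below_rel_imp
        below_rel_neg_imp)
  moreover have "(\<sim> a, \<sim> b) \<in> relative_congruence c"
    if "(a, b) \<in> relative_congruence c" for a b
    using that unfolding relative_congruence_def by (auto simp: neg_neg)
  ultimately show ?thesis unfolding is_congruence_def by blast
qed

section \<open>The equation defining principal congruences\<close>

text \<open>If \<open>e = \<one>\<close>, this says that \<open>z \<rightarrow> w\<close> and \<open>\<sim> w \<rightarrow> \<sim> z\<close> cannot both be \<open>\<one>\<close> unless \<open>z \<sqsubseteq> w\<close>.  The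
  version with an arbitrary \<open>e\<close> can be used modulo any congruence that identifies \<open>e\<close> with \<open>\<one>\<close>.
  The first implication bounds \<open>z \<sqinter> e\<close> by \<open>\<sim> z \<squnion> w\<close>; the part in \<open>\<sim> z\<close> is a contradiction, hence
  below \<open>w \<squnion> \<sim> w\<close> by the Kleene law, and the part of it in \<open>\<sim> w\<close> is bounded by the negated second
  implication.\<close>

lemma meet_leq_join_neg:
  assumes e: "e \<sqsubseteq> z \<rightarrow> w" "e \<sqsubseteq> \<sim> w \<rightarrow> \<sim> z"
    and C [simp]: "e \<in> carrier T" "z \<in> carrier T" "w \<in> carrier T"
  shows "z \<sqinter> e \<sqsubseteq> w \<squnion> \<sim> e"
proof -
  have mp: "a \<sqinter> e \<sqsubseteq> \<sim> a \<squnion> b"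
    if "e \<sqsubseteq> a \<rightarrow> b" and [simp]: "a \<in> carrier T" "b \<in> carrier T" for a b
  proof -
    have "a \<sqinter> e \<sqsubseteq> a \<rightarrow> b" using leq_trans[OF meet_lower2 that(1)] by simp
    then have "a \<sqinter> e \<sqsubseteq> a \<sqinter> (a \<rightarrow> b)" by (simp add: meet_greatest meet_lower1)
    from leq_trans[OF this meet_imp_le] have "a \<sqinter> e \<sqsubseteq> a \<sqinter> (\<sim> a \<squnion> b)" by simp
    from leq_trans[OF this meet_lower2] show ?thesis by simp
  qed
  have w_below: "v \<sqsubseteq> w \<squnion> \<sim> e" if "v \<sqsubseteq> w" "v \<in> carrier T" for v
    using leq_trans[OF that(1) join_upper1] that by simp
  have "\<sim> w \<sqinter> e \<sqsubseteq> w \<squnion> \<sim> z" using mp[OF e(2)] by (simp add: neg_neg)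
  from neg_antimono[OF this] have neg: "\<sim> w \<sqinter> z \<sqsubseteq> w \<squnion> \<sim> e"
    by (simp add: neg_join neg_meet neg_neg)
  have contra: "(z \<sqinter> e) \<sqinter> \<sim> z \<sqsubseteq> w \<squnion> \<sim> e" (is "?u \<sqsubseteq> _")
  proof (rule leq_by_cases)
    have u: "?u \<sqsubseteq> z \<sqinter> e" "?u \<sqsubseteq> \<sim> z" by (simp_all add: meet_lower1 meet_lower2)
    have uz: "?u \<sqsubseteq> z" using leq_trans[OF u(1) meet_lower1] by simp
    have "?u \<sqsubseteq> z \<sqinter> \<sim> z" using u(2) uz by (simp add: meet_greatest)
    moreover have "z \<sqinter> \<sim> z \<sqsubseteq> w \<squnion> \<sim> w" by (simp add: leq_def kleene)
    ultimately show "?u \<sqsubseteq> w \<squnion> \<sim> w" using leq_trans[of ?u "z \<sqinter> \<sim> z" "w \<squnion> \<sim> w"] by simp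
    show "?u \<sqinter> w \<sqsubseteq> w \<squnion> \<sim> e" by (rule w_below) (simp_all add: meet_lower2)
    have "?u \<sqinter> \<sim> w \<sqsubseteq> \<sim> w \<sqinter> z"
      using leq_trans[OF meet_lower1 uz] by (simp add: meet_greatest meet_lower2)
    from leq_trans[OF this neg] show "?u \<sqinter> \<sim> w \<sqsubseteq> w \<squnion> \<sim> e" by simp
  qed simp_all
  show ?thesis
  proof (rule leq_by_cases[OF mp[OF e(1)]])
    show "(z \<sqinter> e) \<sqinter> w \<sqsubseteq> w \<squnion> \<sim> e" by (rule w_below) (simp_all add: meet_lower2)
  qed (simp_all add: contra)
qed

lemma congruence_meet_of_equivalence:
  assumes \<theta>: "is_congruence T \<theta>" and e1: "(e, \<one>) \<in> \<theta>"
    and e: "e \<sqsubseteq> z \<rightarrow> w" "e \<sqsubseteq> \<sim> w \<rightarrow> \<sim> z"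
    and C [simp]: "e \<in> carrier T" "z \<in> carrier T" "w \<in> carrier T"
  shows "(z, z \<sqinter> w) \<in> \<theta>"
proof -
  have eq: "equiv (carrier T) \<theta>" using \<theta> by (simp add: is_congruence_def)
  have refl: "(a, a) \<in> \<theta>" if "a \<in> carrier T" for a
    using eq that by (simp add: equiv_def refl_on_def)
  have ze: "(z \<sqinter> e, z) \<in> \<theta>"
    using \<theta> e1 refl[of z] meet_one[of z] unfolding is_congruence_def by (metis C(2))
  have "(\<sim> e, \<zero>) \<in> \<theta>"
    using \<theta> e1 neg_one unfolding is_congruence_def by metis
  then have "(w \<squnion> \<sim> e, w) \<in> \<theta>"
    using \<theta> refl[of w] join_zero[of w] unfolding is_congruence_def by (metis C(3))
  then have "((z \<sqinter> e) \<sqinter> (w \<squnion> \<sim> e), z \<sqinter> w) \<in> \<theta>"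
    using \<theta> ze unfolding is_congruence_def by blast
  moreover have "(z \<sqinter> e) \<sqinter> (w \<squnion> \<sim> e) = z \<sqinter> e"
    using meet_leq_join_neg[OF e] by (simp add: leq_def)
  ultimately have "(z \<sqinter> e, z \<sqinter> w) \<in> \<theta>" by simp
  then show ?thesis using ze eq unfolding equiv_def by (meson symD transD)
qed

lemma congruence_iff_equivalence_one:
  assumes \<theta>: "is_congruence T \<theta>" and C [simp]: "z \<in> carrier T" "w \<in> carrier T"
  shows "(z, w) \<in> \<theta> \<longleftrightarrow> (equivalence z w, \<one>) \<in> \<theta>"
proof
  have eq: "equiv (carrier T) \<theta>" using \<theta> by (simp add: is_congruence_def)
  assume "(z, w) \<in> \<theta>"
  moreover have "(w, w) \<in> \<theta>" using eq by (simp add: equiv_def refl_on_def)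
  ultimately have "(equivalence z w, equivalence w w) \<in> \<theta>"
    using \<theta> unfolding is_congruence_def equivalence_def by simp
  then show "(equivalence z w, \<one>) \<in> \<theta>" by (simp add: equivalence_refl)
next
  have eq: "equiv (carrier T) \<theta>" using \<theta> by (simp add: is_congruence_def)
  assume e1: "(equivalence z w, \<one>) \<in> \<theta>"
  have "(z, z \<sqinter> w) \<in> \<theta>" "(w, w \<sqinter> z) \<in> \<theta>"
    by (rule congruence_meet_of_equivalence[OF \<theta> e1]; simp add: equivalence_leq)+
  then show "(z, w) \<in> \<theta>"
    using eq meet_commute[of w z] unfolding equiv_def by (metis C symD transD)
qed

lemma principal_congruence_iff:
  assumes C [simp]: "x \<in> carrier T" "y \<in> carrier T" "z \<in> carrier T" "w \<in> carrier T"
  shows "(z, w) \<in> principal_congruence T x y \<longleftrightarrow> equivalence x y \<lesssim> equivalence z w"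
proof
  let ?\<phi> = "relative_congruence (equivalence x y)"
  have "is_congruence T ?\<phi>" by (simp add: is_congruence_relative_congruence)
  moreover have "(x, y) \<in> ?\<phi>" by (simp add: relative_congruence_iff imp_refl)
  moreover assume "(z, w) \<in> principal_congruence T x y"
  ultimately have "(z, w) \<in> ?\<phi>" by (auto simp: principal_congruence_def)
  then show "equivalence x y \<lesssim> equivalence z w" by (simp add: relative_congruence_iff)
next
  assume le: "equivalence x y \<lesssim> equivalence z w"
  have "(z, w) \<in> \<theta>" if \<theta>: "is_congruence T \<theta>" and xy: "(x, y) \<in> \<theta>" for \<theta>
  proof -
    let ?e = "equivalence z w"
    have eq: "equiv (carrier T) \<theta>" using \<theta> by (simp add: is_congruence_def)
    have "(equivalence x y, \<one>) \<in> \<theta>" using xy by (simp add: congruence_iff_equivalence_one[OF \<theta>])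
    moreover have "(?e, ?e) \<in> \<theta>" using eq by (simp add: equiv_def refl_on_def)
    ultimately have "(equivalence x y \<rightarrow> ?e, \<one> \<rightarrow> ?e) \<in> \<theta>"
      using \<theta> unfolding is_congruence_def by blast
    then have 1: "(\<one>, \<one> \<rightarrow> ?e) \<in> \<theta>" using le by simp
    \<comment> \<open>modulo \<open>\<theta>\<close>, \<open>\<one> = \<one> \<rightarrow> e \<sqsubseteq> e\<close>\<close>
    have "(\<one> \<sqinter> ?e, (\<one> \<rightarrow> ?e) \<sqinter> ?e) \<in> \<theta>"
      using 1 \<theta> \<open>(?e, ?e) \<in> \<theta>\<close> unfolding is_congruence_def by blast
    moreover have "(\<one> \<rightarrow> ?e) \<sqinter> ?e = \<one> \<rightarrow> ?e" using one_imp_leq[of ?e] by (simp add: leq_def)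
    ultimately have "(?e, \<one> \<rightarrow> ?e) \<in> \<theta>" by (simp add: one_meet)
    then have "(?e, \<one>) \<in> \<theta>" using 1 eq unfolding equiv_def by (meson symD transD)
    then show ?thesis by (simp add: congruence_iff_equivalence_one[OF \<theta>])
  qed
  then show "(z, w) \<in> principal_congruence T x y" by (auto simp: principal_congruence_def)
qed

end

definition equivalence_term :: "'v nelson_term \<Rightarrow> 'v nelson_term \<Rightarrow> 'v nelson_term"
  where "equivalence_term s t =
    Meet (Meet (Meet (Imp s t) (Imp t s)) (Imp (Neg s) (Neg t))) (Imp (Neg t) (Neg s))"

definition edpc_equations :: "(var4 nelson_term \<times> var4 nelson_term) list"
  where "edpc_equations =
    [(Imp (equivalence_term (Var V1) (Var V2)) (equivalence_term (Var V3) (Var V4)), One)]"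

lemma edpc_equations_define_principal_congruences:
  "defines_principal_congruences (SNA TYPE('a)) edpc_equations"
  unfolding defines_principal_congruences_def
proof (intro ballI)
  fix T :: "'a nelson_struct" and x y z w
  assume "T \<in> SNA TYPE('a)"
    and C: "x \<in> carrier T" "y \<in> carrier T" "z \<in> carrier T" "w \<in> carrier T"
  then interpret subresiduated_nelson_algebra T by (simp add: SNA_def)
  show "(z, w) \<in> principal_congruence T x y \<longleftrightarrow>
      (\<forall>(p, q)\<in>set edpc_equations. eval4 T p x y z w = eval4 T q x y z w)"
    using principal_congruence_iff[OF C]
    by (simp add: edpc_equations_def eval4_def equivalence_term_def equivalence_def)
qed

section \<open>Reduction to algebras of naturals\<close>

text \<open>\<open>g\<close> is an injective homomorphism.  The laws that its domain inherits from \<open>T\<close> are pulled back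
  along it, so that the domain need not be constructed as a subset of the type of \<open>T\<close>.\<close>

locale nelson_embedding = subresiduated_nelson_algebra T
  for T :: "'a nelson_struct" (structure) +
  fixes N :: "'b nelson_struct" and g :: "'b \<Rightarrow> 'a"
  assumes inj: "inj_on g (carrier N)"
    and g_carrier [simp]: "a \<in> carrier N \<Longrightarrow> g a \<in> carrier T"
    and N_meet [simp]: "\<lbrakk>a \<in> carrier N; b \<in> carrier N\<rbrakk> \<Longrightarrow> a \<sqinter>\<^bsub>N\<^esub> b \<in> carrier N"
    and N_join [simp]: "\<lbrakk>a \<in> carrier N; b \<in> carrier N\<rbrakk> \<Longrightarrow> a \<squnion>\<^bsub>N\<^esub> b \<in> carrier N"
    and N_imp [simp]: "\<lbrakk>a \<in> carrier N; b \<in> carrier N\<rbrakk> \<Longrightarrow> a \<rightarrow>\<^bsub>N\<^esub> b \<in> carrier N"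
    and N_neg [simp]: "a \<in> carrier N \<Longrightarrow> \<sim>\<^bsub>N\<^esub> a \<in> carrier N"
    and N_zero [simp]: "\<zero>\<^bsub>N\<^esub> \<in> carrier N"
    and N_one [simp]: "\<one>\<^bsub>N\<^esub> \<in> carrier N"
    and g_meet [simp]: "\<lbrakk>a \<in> carrier N; b \<in> carrier N\<rbrakk> \<Longrightarrow> g (a \<sqinter>\<^bsub>N\<^esub> b) = g a \<sqinter> g b"
    and g_join [simp]: "\<lbrakk>a \<in> carrier N; b \<in> carrier N\<rbrakk> \<Longrightarrow> g (a \<squnion>\<^bsub>N\<^esub> b) = g a \<squnion> g b"
    and g_imp [simp]: "\<lbrakk>a \<in> carrier N; b \<in> carrier N\<rbrakk> \<Longrightarrow> g (a \<rightarrow>\<^bsub>N\<^esub> b) = g a \<rightarrow> g b"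
    and g_neg [simp]: "a \<in> carrier N \<Longrightarrow> g (\<sim>\<^bsub>N\<^esub> a) = \<sim> (g a)"
    and g_zero [simp]: "g \<zero>\<^bsub>N\<^esub> = \<zero>"
    and g_one [simp]: "g \<one>\<^bsub>N\<^esub> = \<one>"
begin

lemma eq_iff: "\<lbrakk>a \<in> carrier N; b \<in> carrier N\<rbrakk> \<Longrightarrow> a = b \<longleftrightarrow> g a = g b"
  using inj by (auto dest: inj_onD)

lemma leq_iff: "\<lbrakk>a \<in> carrier N; b \<in> carrier N\<rbrakk> \<Longrightarrow> a \<sqsubseteq>\<^bsub>N\<^esub> b \<longleftrightarrow> g a \<sqsubseteq> g b"
  by (simp add: leq_def eq_iff)

lemma subresiduated_nelson_algebra_domain: "subresiduated_nelson_algebra N"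
proof (unfold_locales, goal_cases)
  case (6 x y z) then show ?case by (simp add: eq_iff meet_assoc)
next
  case (7 x y z) then show ?case by (simp add: eq_iff join_assoc)
next
  case (8 x y) then show ?case using meet_commute[of "g x" "g y"] by (simp add: eq_iff)
next
  case (9 x y) then show ?case using join_commute[of "g x" "g y"] by (simp add: eq_iff)
next
  case (12 x y z) then show ?case by (simp add: eq_iff meet_join_distrib)
next
  case (20 x y z) then show ?case by (simp add: eq_iff imp_meet)
qed (simp_all add: leq_iff,
     simp_all add: eq_iff meet_join_absorb join_meet_absorb zero_least
       one_greatest neg_neg neg_meet kleene join_imp imp_trans imp_refl
       meet_imp_le imp_le_imp neg_imp_imp imp_neg_imp)

lemma eval_domain:
  assumes "\<And>v. \<rho> v \<in> carrier N"
  shows "eval N \<rho> t \<in> carrier N \<and> g (eval N \<rho> t) = eval T (\<lambda>v. g (\<rho> v)) t"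
  by (induction t) (auto simp: assms)

lemma eval4_eq_iff:
  assumes "a \<in> carrier N" "b \<in> carrier N" "c \<in> carrier N" "d \<in> carrier N"
  shows "eval4 N p a b c d = eval4 N q a b c d \<longleftrightarrow>
    eval4 T p (g a) (g b) (g c) (g d) = eval4 T q (g a) (g b) (g c) (g d)"
proof -
  let ?\<rho> = "case_var4 a b c d"
  have \<rho>: "?\<rho> v \<in> carrier N" for v using assms by (cases v) auto
  have "(\<lambda>v. g (?\<rho> v)) = case_var4 (g a) (g b) (g c) (g d)"
    by (rule ext) (simp split: var4.split)
  then show ?thesis
    using eval_domain[of ?\<rho>, OF \<rho>] by (simp add: eval4_def eq_iff)
qed

end

instance var4 :: countable
  by countable_datatype

instance nelson_term :: (countable) countable
  by countable_datatype

lemma (in subresiduated_nelson_algebra) eval_closed: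
  assumes "\<And>v. \<rho> v \<in> carrier T"
  shows "eval T \<rho> t \<in> carrier T"
  by (induction t) (auto simp: assms)

text \<open>The subalgebra generated by the values of countably many variables consists of the values of
  terms; each value is coded by one of the terms that denote it.\<close>

lemma (in subresiduated_nelson_algebra) embedding_of_naturals:
  fixes \<rho> :: "'v::countable \<Rightarrow> 'a"
  assumes \<rho>: "\<And>v. \<rho> v \<in> carrier T"
  obtains N :: "nat nelson_struct" and g where "nelson_embedding T N g" "range \<rho> \<subseteq> g ` carrier N"
proof -
  define S where "S = range (eval T \<rho>)"
  define f where "f = (\<lambda>s. to_nat (inv (eval T \<rho>) s))"
  define g where "g = (\<lambda>n. eval T \<rho> (from_nat n))"
  define N where "N = \<lparr>carrier = f ` S,
    meet = (\<lambda>m n. f (g m \<sqinter> g n)), join = (\<lambda>m n. f (g m \<squnion> g n)),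
    imp = (\<lambda>m n. f (g m \<rightarrow> g n)), neg = (\<lambda>n. f (\<sim> (g n))), zero = f \<zero>, one = f \<one>\<rparr>"
  have gf [simp]: "g (f s) = s" if "s \<in> S" for s
    using that by (simp add: f_def g_def S_def f_inv_into_f)
  have S_carrier: "S \<subseteq> carrier T" using eval_closed \<rho> by (auto simp: S_def)
  have S_ops: "a \<sqinter> b \<in> S" "a \<squnion> b \<in> S" "a \<rightarrow> b \<in> S" "\<sim> a \<in> S" if "a \<in> S" "b \<in> S" for a b
  proof -
    from that obtain s t where st: "a = eval T \<rho> s" "b = eval T \<rho> t" by (auto simp: S_def)
    show "a \<sqinter> b \<in> S" unfolding S_def by (rule range_eqI[of _ _ "Meet s t"]) (simp add: st)
    show "a \<squnion> b \<in> S" unfolding S_def by (rule range_eqI[of _ _ "Join s t"]) (simp add: st)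
    show "a \<rightarrow> b \<in> S" unfolding S_def by (rule range_eqI[of _ _ "Imp s t"]) (simp add: st)
    show "\<sim> a \<in> S" unfolding S_def by (rule range_eqI[of _ _ "Neg s"]) (simp add: st)
  qed
  have S_consts: "\<zero> \<in> S" "\<one> \<in> S"
    unfolding S_def by (rule range_eqI[of _ _ Zero], simp) (rule range_eqI[of _ _ One], simp)
  have "nelson_embedding T N g"
  proof unfold_locales
    show "inj_on g (carrier N)" by (auto simp: N_def intro!: inj_onI)
  qed (use S_carrier in \<open>auto simp: N_def S_ops S_consts\<close>)
  moreover have "range \<rho> \<subseteq> g ` carrier N"
  proof
    fix a assume "a \<in> range \<rho>"
    then obtain v where "a = eval T \<rho> (Var v)" by auto
    then have "a \<in> S" unfolding S_def by blast
    then have "g (f a) = a" "f a \<in> carrier N" by (auto simp: N_def)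
    then show "a \<in> g ` carrier N" by (metis imageI)
  qed
  ultimately show ?thesis by (rule that)
qed

lemma defines_principal_congruencesD:
  assumes "defines_principal_congruences K ps" "T \<in> K"
    and "x \<in> carrier T" "y \<in> carrier T" "z \<in> carrier T" "w \<in> carrier T"
  shows "(z, w) \<in> principal_congruence T x y \<longleftrightarrow>
    (\<forall>(p, q)\<in>set ps. eval4 T p x y z w = eval4 T q x y z w)"
  using assms unfolding defines_principal_congruences_def by simp

text \<open>The truth of \<open>ps\<close> and that of \<open>edpc_equations\<close> are compared inside an algebra of naturals,
  where both are equivalent to membership in the principal congruence.  Principal congruences
  themselves are never transferred between an algebra and a subalgebra.\<close>

lemma defines_principal_congruences_transfer:
  assumes ps: "defines_principal_congruences (SNA TYPE(nat)) ps"
  shows "defines_principal_congruences (SNA TYPE('a)) ps"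
proof -
  have "(z, w) \<in> principal_congruence T x y \<longleftrightarrow>
      (\<forall>(p, q)\<in>set ps. eval4 T p x y z w = eval4 T q x y z w)"
    if T: "T \<in> SNA TYPE('a)"
      and C: "x \<in> carrier T" "y \<in> carrier T" "z \<in> carrier T" "w \<in> carrier T" for T x y z w
  proof -
    interpret subresiduated_nelson_algebra T using T by (simp add: SNA_def)
    let ?\<rho> = "case_var4 x y z w"
    have "?\<rho> v \<in> carrier T" for v using C by (cases v) auto
    from embedding_of_naturals[of ?\<rho>, OF this]
    obtain N :: "nat nelson_struct" and g
      where emb: "nelson_embedding T N g" and range: "range ?\<rho> \<subseteq> g ` carrier N" by blast
    interpret N: nelson_embedding T N g by (rule emb)
    have "?\<rho> v \<in> g ` carrier N" for v using range by blast
    from this[of V1] this[of V2] this[of V3] this[of V4] obtain a b c d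
      where N: "a \<in> carrier N" "b \<in> carrier N" "c \<in> carrier N" "d \<in> carrier N"
        and g: "g a = x" "g b = y" "g c = z" "g d = w" by auto
    have transfer: "(\<forall>(p, q)\<in>set es. eval4 T p x y z w = eval4 T q x y z w) \<longleftrightarrow>
        (\<forall>(p, q)\<in>set es. eval4 N p a b c d = eval4 N q a b c d)" for es
      using N.eval4_eq_iff[OF N] by (simp add: g)
    have N_SNA: "N \<in> SNA TYPE(nat)"
      using N.subresiduated_nelson_algebra_domain by (simp add: SNA_def)
    have "(z, w) \<in> principal_congruence T x y \<longleftrightarrow>
        (\<forall>(p, q)\<in>set edpc_equations. eval4 N p a b c d = eval4 N q a b c d)"
      unfolding transfer[symmetric]
      by (rule defines_principal_congruencesD[OF edpc_equations_define_principal_congruences T C])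
    also have "\<dots> \<longleftrightarrow> (c, d) \<in> principal_congruence N a b"
      by (rule defines_principal_congruencesD[OF edpc_equations_define_principal_congruences
            N_SNA N, symmetric])
    also have "\<dots> \<longleftrightarrow> (\<forall>(p, q)\<in>set ps. eval4 N p a b c d = eval4 N q a b c d)"
      by (rule defines_principal_congruencesD[OF ps N_SNA N])
    finally show ?thesis unfolding transfer .
  qed
  then show ?thesis unfolding defines_principal_congruences_def by (intro ballI)
qed

theorem corollary4p12:
  "(\<exists>ps. defines_principal_congruences (SNA TYPE(nat)) ps) \<and>
   (\<forall>ps. defines_principal_congruences (SNA TYPE(nat)) ps \<longrightarrow>
      defines_principal_congruences (SNA TYPE('a)) ps)"
  using edpc_equations_define_principal_congruences defines_principal_congruences_transfer
  by blast

end
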